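(* Let $(X,d)$ be a flat complete $\mathrm{CAT}(0)$ space and let $K\subseteq X$ be a compact set. Then $\operatorname{cl}\operatorname{co}K$ is compact. If additionally $K$ is finite, then $\operatorname{co}K$ is compact.
   Context: A $\mathrm{CAT}(0)$ space is a geodesic metric space in which every geodesic triangle is at least as thin as its Euclidean comparison triangle; it is uniquely geodesic, and $[x,y]$ denotes the geodesic segment joining $x$ and $y$. For $t\in[0,1]$, $x_t:=(1-t)x\oplus ty$ is the point of $[x,y]$ with $d(x_t,x)=t\,d(x,y)$. In a $\mathrm{CAT}(0)$ space one has $$d(x_t,z)^2\le(1-t)d(x,z)^2+t\,d(y,z)^2-t(1-t)d(x,y)^2\qquad\text{for all }x,y,z\in X,\ t\in[0,1],$$ and the space is called flat if this holds with equality for all $x,y,z\in X$ and all $t\in[0,1]$. A set $C\subseteq X$ is convex if $[x,y]\subseteq C$ for all $x,y\in C$; $\operatorname{co}K$ is the smallest convex set containing $K$, and $\operatorname{cl}$ denotes closure. *)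

theory Defs
  imports "HOL-Analysis.Analysis"
begin

context metric_space
begin

definition is_geodesic_segment :: "'a set \<Rightarrow> 'a \<Rightarrow> 'a \<Rightarrow> bool" where
  "is_geodesic_segment S x y \<longleftrightarrow>
     (\<exists>\<gamma> :: real \<Rightarrow> 'a. \<gamma> 0 = x \<and> \<gamma> (dist x y) = y \<and>
        (\<forall>s\<in>{0..dist x y}. \<forall>t\<in>{0..dist x y}. dist (\<gamma> s) (\<gamma> t) = \<bar>s - t\<bar>) \<and>
        S = \<gamma> ` {0..dist x y})"

definition on_side :: "'a set \<Rightarrow> 'a \<Rightarrow> real^2 \<Rightarrow> real^2 \<Rightarrow> 'a \<Rightarrow> real^2 \<Rightarrow> bool" where
  "on_side S x x' y' p p' \<longleftrightarrow>
     p \<in> S \<and> p' \<in> closed_segment x' y' \<and> dist x' p' = dist x p"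

text \<open>
  The geodesic triangle has vertices \<open>x\<close>, \<open>y\<close>, \<open>z\<close> and sides \<open>A\<close>, \<open>B\<close>, \<open>C\<close> joining
  \<open>x, y\<close> and \<open>y, z\<close> and \<open>z, x\<close>; its comparison triangle has vertices \<open>x'\<close>, \<open>y'\<close>, \<open>z'\<close>.
  The point \<open>p'\<close> is a comparison point for the point \<open>p\<close> of the triangle.
\<close>
definition comparison_point ::
  "'a \<Rightarrow> 'a \<Rightarrow> 'a \<Rightarrow> 'a set \<Rightarrow> 'a set \<Rightarrow> 'a set \<Rightarrow>
   real^2 \<Rightarrow> real^2 \<Rightarrow> real^2 \<Rightarrow> 'a \<Rightarrow> real^2 \<Rightarrow> bool" where
  "comparison_point x y z A B C x' y' z' p p' \<longleftrightarrow>
     on_side A x x' y' p p' \<or> on_side B y y' z' p p' \<or> on_side C z z' x' p p'"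

text \<open>
  In a uniquely geodesic space, \<open>geodesic_segment x y\<close> is $[x,y]$ and
  \<open>geodesic_point x y t\<close> is $(1-t)x \oplus ty$.
\<close>
definition geodesic_segment :: "'a \<Rightarrow> 'a \<Rightarrow> 'a set" where
  "geodesic_segment x y = (THE S. is_geodesic_segment S x y)"

definition geodesic_point :: "'a \<Rightarrow> 'a \<Rightarrow> real \<Rightarrow> 'a" where
  "geodesic_point x y t = (THE p. p \<in> geodesic_segment x y \<and> dist p x = t * dist x y)"

definition geodesically_convex :: "'a set \<Rightarrow> bool" where
  "geodesically_convex C \<longleftrightarrow> (\<forall>x\<in>C. \<forall>y\<in>C. geodesic_segment x y \<subseteq> C)"

end

class cat0_space = metric_space +
  assumes geodesic: "\<exists>S. is_geodesic_segment S x y"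
    and thin_triangles:
      "is_geodesic_segment A x y \<Longrightarrow> is_geodesic_segment B y z \<Longrightarrow> is_geodesic_segment C z x \<Longrightarrow>
       dist x' y' = dist x y \<Longrightarrow> dist y' z' = dist y z \<Longrightarrow> dist z' x' = dist z x \<Longrightarrow>
       comparison_point x y z A B C x' y' z' p p' \<Longrightarrow>
       comparison_point x y z A B C x' y' z' q q' \<Longrightarrow>
       dist p q \<le> dist p' q'"

class flat_cat0_space = cat0_space +
  assumes flat:
    "0 \<le> t \<Longrightarrow> t \<le> 1 \<Longrightarrow>
     (dist (geodesic_point x y t) z)\<^sup>2 =
       (1 - t) * (dist x z)\<^sup>2 + t * (dist y z)\<^sup>2 - t * (1 - t) * (dist x y)\<^sup>2"

text \<open>The definite descriptions above are well defined in every \<open>cat0_space\<close>, for $0 \le t \le 1$.\<close>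

lemma is_geodesic_segment_unique:
  fixes x y :: "'a::cat0_space"
  assumes S: "is_geodesic_segment S x y" and T: "is_geodesic_segment T x y"
  shows "S = T"
proof -
  have *: "S \<subseteq> T" if S: "is_geodesic_segment S x y" and T: "is_geodesic_segment T x y"
    for S T and x y :: 'a
  proof
    fix p assume "p \<in> S"
    obtain g where g: "g 0 = x" "S = g ` {0..dist x y}"
      "\<forall>s\<in>{0..dist x y}. \<forall>t\<in>{0..dist x y}. dist (g s) (g t) = \<bar>s - t\<bar>"
      using S unfolding is_geodesic_segment_def by blast
    obtain h where h: "h 0 = x" "h (dist x y) = y" "T = h ` {0..dist x y}"
      "\<forall>s\<in>{0..dist x y}. \<forall>t\<in>{0..dist x y}. dist (h s) (h t) = \<bar>s - t\<bar>"
      using T unfolding is_geodesic_segment_def by blast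
    obtain s where s: "s \<in> {0..dist x y}" "p = g s"
      using \<open>p \<in> S\<close> g by blast
    have B: "is_geodesic_segment {y} y y"
      unfolding is_geodesic_segment_def by (rule exI[of _ "\<lambda>_. y"]) auto
    have C: "is_geodesic_segment T y x"
      unfolding is_geodesic_segment_def
    proof (intro exI[of _ "\<lambda>t. h (dist x y - t)"] conjI)
      show "\<forall>s\<in>{0..dist y x}. \<forall>t\<in>{0..dist y x}.
              dist (h (dist x y - s)) (h (dist x y - t)) = \<bar>s - t\<bar>"
        using h(4) by (auto simp: dist_commute)
      have "(\<lambda>t. dist x y - t) ` {0..dist x y} = {0..dist x y}"
        by simp
      then show "T = (\<lambda>t. h (dist x y - t)) ` {0..dist y x}"
        using h(3) by (metis dist_commute image_image)
    qed (use h in \<open>auto simp: dist_commute\<close>)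
    define e :: "real^2" where "e = axis 1 1"
    define y' where "y' = dist x y *\<^sub>R e"
    define p' where "p' = s *\<^sub>R e"
    have "dist (a *\<^sub>R e) (b *\<^sub>R e) = \<bar>a - b\<bar>" for a b
      by (simp add: dist_norm e_def flip: scaleR_left_diff_distrib)
    from this[of 0 "dist x y"] this[of 0 s] this[of "dist x y" s]
    have d: "dist 0 y' = dist x y" "dist 0 p' = s" "dist y' p' = dist x y - s"
      using s(1) by (auto simp: y'_def p'_def)
    have seg: "p' \<in> closed_segment 0 y'"
      unfolding between_mem_segment[symmetric] between using d by (simp add: dist_commute)
    have p: "dist x p = s" using g s by force
    have hs: "dist x (h s) = s" "dist y (h s) = dist x y - s" "h s \<in> T"
      proof -
      show "dist x (h s) = s"
        using h(4)[rule_format, of 0 s] h(1) s(1) by simp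
      show "dist y (h s) = dist x y - s"
        using h(4)[rule_format, of "dist x y" s] h(2) s(1) by simp
      show "h s \<in> T" using h(3) s(1) by simp
    qed
    have "dist p (h s) \<le> dist p' p'"
    proof (rule thin_triangles[OF S B C])
      show "comparison_point x y y S {y} T 0 y' y' p p'"
        using \<open>p \<in> S\<close> seg d p by (auto simp: comparison_point_def on_side_def)
      show "comparison_point x y y S {y} T 0 y' y' (h s) p'"
        using hs seg d unfolding comparison_point_def on_side_def
        by (metis closed_segment_commute)
    qed (use d in \<open>auto simp: dist_commute\<close>)
    then show "p \<in> T" using hs by simp
  qed
  show ?thesis using *[OF S T] *[OF T S] by blast
qed

lemma is_geodesic_segment_geodesic_segment:
  fixes x y :: "'a::cat0_space"
  shows "is_geodesic_segment (geodesic_segment x y) x y"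
  unfolding geodesic_segment_def
  by (rule theI') (use geodesic is_geodesic_segment_unique in blast)

lemma geodesic_point_unique:
  fixes x y :: "'a::cat0_space"
  assumes "0 \<le> t" "t \<le> 1"
  shows "\<exists>!p. p \<in> geodesic_segment x y \<and> dist p x = t * dist x y"
proof -
  obtain g where g: "g 0 = x" "geodesic_segment x y = g ` {0..dist x y}"
      "\<forall>s\<in>{0..dist x y}. \<forall>t\<in>{0..dist x y}. dist (g s) (g t) = \<bar>s - t\<bar>"
    using is_geodesic_segment_geodesic_segment[of x y] unfolding is_geodesic_segment_def by blast
  have d: "dist (g s) x = s" if "s \<in> {0..dist x y}" for s
    using g that by force
  have "t * dist x y \<in> {0..dist x y}"
    using assms by (auto simp: mult_left_le_one_le)
  then show ?thesis using d g(2) by (intro ex1I[of _ "g (t * dist x y)"]) auto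
qed

end

theory Submission
  imports Defs
begin

text \<open>
  By flatness, a point is determined by the squared distance function to it up to an additive
  constant, and repeated convex combinations have squared distance functions that are weighted
  sums of those of the original points. Hence the union of the segments from \<open>x\<close> to a convex set
  is convex, so hulls of finite sets arise by iterating a continuous image of
  \<open>[0,1] \<times> C\<close> and are compact. For compact \<open>K\<close>, a neighbourhood of the hull of a finite net is
  convex and therefore contains the hull of \<open>K\<close>, which is thus totally bounded.
\<close>

section \<open>Parametrised segments and convexity\<close>

lemma geodesic_point_in_segment:
  fixes x y :: "'a::cat0_space"
  assumes "0 \<le> t" "t \<le> 1"
  shows "geodesic_point x y t \<in> geodesic_segment x y"
  using theI'[OF geodesic_point_unique[OF assms, of x y]] by (simp add: geodesic_point_def)

lemma geodesic_segment_eq_image: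
  fixes x y :: "'a::cat0_space"
  shows "geodesic_segment x y = geodesic_point x y ` {0..1}"
proof
  show "geodesic_point x y ` {0..1} \<subseteq> geodesic_segment x y"
    using geodesic_point_in_segment by auto
  show "geodesic_segment x y \<subseteq> geodesic_point x y ` {0..1}"
  proof
    fix p assume p: "p \<in> geodesic_segment x y"
    obtain g where g: "g 0 = x" "geodesic_segment x y = g ` {0..dist x y}"
      "\<forall>s\<in>{0..dist x y}. \<forall>t\<in>{0..dist x y}. dist (g s) (g t) = \<bar>s - t\<bar>"
      using is_geodesic_segment_geodesic_segment[of x y] unfolding is_geodesic_segment_def by blast
    obtain s where s: "s \<in> {0..dist x y}" "p = g s" using p g by blast
    have px: "dist p x = s" using g s by force
    \<comment> \<open>If x = y, then s = 0 and division by zero gives t = 0, so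
      \<open>s = t * dist x y\<close> survives.\<close>
    define t where "t = s / dist x y"
    have t: "0 \<le> t" "t \<le> 1" and st: "s = t * dist x y"
      using s(1) by (auto simp: t_def divide_le_eq_1)
    have "geodesic_point x y t = p"
      unfolding geodesic_point_def
      by (rule the1_equality[OF geodesic_point_unique[OF t]]) (use p px st in auto)
    then show "p \<in> geodesic_point x y ` {0..1}" using t by force
  qed
qed

lemma geodesically_convex_iff:
  fixes C :: "'a::cat0_space set"
  shows "geodesically_convex C \<longleftrightarrow>
    (\<forall>x\<in>C. \<forall>y\<in>C. \<forall>t\<in>{0..1}. geodesic_point x y t \<in> C)"
  unfolding geodesically_convex_def geodesic_segment_eq_image by blast

text \<open>Phrased through points, convexity is visibly stable under intersections, which is what a
  hull needs.\<close>

lemma geodesically_convex_hull: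
  fixes S :: "'a::cat0_space set"
  shows "geodesically_convex (geodesically_convex hull S)"
  by (rule hull_in) (unfold geodesically_convex_iff, blast)

section \<open>Distance formulas in flat spaces\<close>

text \<open>Evaluating at p and q gives f p = a and f q = b, so the squared distance equals both b -
  a and a - b.\<close>

lemma point_eq_if_dist_square_differ_by_const:
  fixes p q :: "'a::metric_space"
  assumes p: "\<And>z. (dist p z)\<^sup>2 = f z - a" and q: "\<And>z. (dist q z)\<^sup>2 = f z - b"
  shows "p = q"
proof -
  have "(dist p q)\<^sup>2 = 0"
    using p[of p] p[of q] q[of p] q[of q] by (simp add: dist_commute)
  then show ?thesis by simp
qed

lemma geodesic_point_0 [simp]:
  fixes x y :: "'a::flat_cat0_space"
  shows "geodesic_point x y 0 = x"
  using flat[of 0 x y x] by simp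

lemma geodesic_point_1 [simp]:
  fixes x y :: "'a::flat_cat0_space"
  shows "geodesic_point x y 1 = y"
  using flat[of 1 x y y] by simp

lemma dist_square_geodesic_points:
  fixes x y x' y' :: "'a::flat_cat0_space"
  assumes s: "0 \<le> s" "s \<le> 1" and t: "0 \<le> t" "t \<le> 1"
  shows "(dist (geodesic_point x y s) (geodesic_point x' y' t))\<^sup>2 =
    (1 - s) * ((1 - t) * (dist x x')\<^sup>2 + t * (dist x y')\<^sup>2 - t * (1 - t) * (dist x' y')\<^sup>2) +
    s * ((1 - t) * (dist y x')\<^sup>2 + t * (dist y y')\<^sup>2 - t * (1 - t) * (dist x' y')\<^sup>2) -
    s * (1 - s) * (dist x y)\<^sup>2"
proof -
  have "(dist z (geodesic_point x' y' t))\<^sup>2 =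
      (1 - t) * (dist z x')\<^sup>2 + t * (dist z y')\<^sup>2 - t * (1 - t) * (dist x' y')\<^sup>2" for z
    using flat[OF t, of x' y' z] by (simp only: dist_commute)
  then show ?thesis unfolding flat[OF s] by (simp only:)
qed

text \<open>The right side minus the left is four times the squared distance between the midpoints
  of the diagonals [x,y'] and [y,x'].\<close>

lemma quadrilateral_inequality:
  fixes x y x' y' :: "'a::flat_cat0_space"
  shows "(dist x y')\<^sup>2 + (dist y x')\<^sup>2 \<le>
    (dist x x')\<^sup>2 + (dist y y')\<^sup>2 + (dist x y)\<^sup>2 + (dist x' y')\<^sup>2"
proof -
  have "0 \<le> (dist (geodesic_point x y' (1/2)) (geodesic_point y x' (1/2)))\<^sup>2" by simp
  then show ?thesis
    unfolding dist_square_geodesic_points[of "1/2" "1/2" x y' y x', simplified]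
    by (simp add: field_simps dist_commute)
qed

text \<open>The quadrilateral inequality bounds the two cross terms of the expansion; the terms in
  [x,y] and [x',y'] then cancel.\<close>

lemma dist_square_geodesic_points_le:
  fixes x y x' y' :: "'a::flat_cat0_space"
  assumes t: "0 \<le> t" "t \<le> 1"
  shows "(dist (geodesic_point x y t) (geodesic_point x' y' t))\<^sup>2 \<le>
    (1 - t) * (dist x x')\<^sup>2 + t * (dist y y')\<^sup>2"
proof -
  have "t * (1 - t) * ((dist x y')\<^sup>2 + (dist y x')\<^sup>2) \<le>
    t * (1 - t) * ((dist x x')\<^sup>2 + (dist y y')\<^sup>2 + (dist x y)\<^sup>2 + (dist x' y')\<^sup>2)"
    using t by (intro mult_left_mono quadrilateral_inequality) auto
  then show ?thesis
    unfolding dist_square_geodesic_points[OF t t] by (simp add: algebra_simps power2_eq_square)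
qed

lemma dist_geodesic_points_same_segment:
  fixes x y :: "'a::flat_cat0_space"
  assumes "0 \<le> s" "s \<le> 1" "0 \<le> t" "t \<le> 1"
  shows "dist (geodesic_point x y s) (geodesic_point x y t) = \<bar>s - t\<bar> * dist x y"
proof -
  have "(dist (geodesic_point x y s) (geodesic_point x y t))\<^sup>2 = (\<bar>s - t\<bar> * dist x y)\<^sup>2"
    unfolding dist_square_geodesic_points[OF assms] power_mult_distrib power2_abs
    by (simp add: dist_commute algebra_simps power2_eq_square)
  then show ?thesis by (simp add: power2_eq_iff_nonneg)
qed

section \<open>Convex neighbourhoods and cones\<close>

lemma geodesically_convex_neighbourhood:
  fixes C :: "'a::flat_cat0_space set"
  assumes C: "geodesically_convex C"
  shows "geodesically_convex (\<Union>c\<in>C. ball c e)"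
  unfolding geodesically_convex_iff
proof (intro ballI)
  fix x y and t :: real
  assume "x \<in> (\<Union>c\<in>C. ball c e)" "y \<in> (\<Union>c\<in>C. ball c e)" "t \<in> {0..1}"
  then obtain a b where ab: "a \<in> C" "b \<in> C" "dist a x < e" "dist b y < e" and t: "0 \<le> t" "t \<le> 1"
    by auto
  \<comment> \<open>A common bound for both distances that is still strictly below e, as the open
    ball requires.\<close>
  define m where "m = max (dist a x) (dist b y)"
  have m: "0 \<le> m" "m < e" "dist a x \<le> m" "dist b y \<le> m"
    using ab by (auto simp: m_def le_max_iff_disj)
  have "(dist (geodesic_point a b t) (geodesic_point x y t))\<^sup>2 \<le>
      (1 - t) * (dist a x)\<^sup>2 + t * (dist b y)\<^sup>2"
    by (rule dist_square_geodesic_points_le[OF t])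
  also have "\<dots> \<le> (1 - t) * m\<^sup>2 + t * m\<^sup>2"
    using t m by (intro add_mono mult_left_mono power_mono) auto
  also have "\<dots> = m\<^sup>2" by (simp add: algebra_simps)
  finally have "dist (geodesic_point a b t) (geodesic_point x y t) \<le> m"
    using m(1) by (rule power2_le_imp_le)
  then have "geodesic_point x y t \<in> ball (geodesic_point a b t) e" using m by simp
  moreover have "geodesic_point a b t \<in> C" using C ab t by (auto simp: geodesically_convex_iff)
  ultimately show "geodesic_point x y t \<in> (\<Union>c\<in>C. ball c e)" by blast
qed

text \<open>
  Both sides have weights \<open>(1 - r) * (1 - s) + r * (1 - t)\<close>, \<open>(1 - r) * s\<close>, \<open>r * t\<close> at
  \<open>x\<close>, \<open>c\<close>, \<open>d\<close>.
\<close>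
lemma geodesic_point_cone:
  fixes x c d :: "'a::flat_cat0_space"
  assumes r: "0 \<le> r" "r \<le> 1" and s: "0 \<le> s" "s \<le> 1" and t: "0 \<le> t" "t \<le> 1"
  obtains l u where "0 \<le> l" "l \<le> 1" "0 \<le> u" "u \<le> 1"
    "geodesic_point (geodesic_point x c s) (geodesic_point x d t) r =
      geodesic_point x (geodesic_point c d u) l"
proof -
  \<comment> \<open>l is the joint weight of c and d, and u is the share of d in it. If l = 0,
    division by zero gives u = 0, which is admissible, and r * t = 0 as well.\<close>
  define l where "l = (1 - r) * s + r * t"
  define u where "u = r * t / l"
  have rs: "0 \<le> (1 - r) * s" and rt: "0 \<le> r * t" using r s t by auto
  have l0: "0 \<le> l" using rs rt by (simp add: l_def)
  have l1: "l \<le> 1" unfolding l_def using convex_bound_le[of s 1 t "1 - r" r] r s t by simp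
  have u: "0 \<le> u" "u \<le> 1" using rs rt l0 by (auto simp: u_def l_def divide_le_eq_1)
  have lu: "l * u = r * t"
  proof (cases "l = 0")
    case True
    then have "r * t = 0" using rs rt unfolding l_def by linarith
    then show ?thesis using True by simp
  qed (simp add: u_def)
  have lu': "l * (1 - u) = (1 - r) * s" using lu by (simp add: l_def algebra_simps)
  have l': "1 - l = (1 - r) * (1 - s) + r * (1 - t)" by (simp add: l_def algebra_simps)
  \<comment> \<open>The weighted sum shared by both points: their squared distances to z differ from
    f z by terms free of z.\<close>
  define f where "f z = (1 - l) * (dist x z)\<^sup>2 + (l * (1 - u)) * (dist c z)\<^sup>2
    + (l * u) * (dist d z)\<^sup>2" for z
  have "geodesic_point (geodesic_point x c s) (geodesic_point x d t) r =
      geodesic_point x (geodesic_point c d u) l"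
  proof (rule point_eq_if_dist_square_differ_by_const)
    show "(dist (geodesic_point x (geodesic_point c d u) l) z)\<^sup>2 =
        f z - (l * u * (1 - u) * (dist c d)\<^sup>2 + l * (1 - l) * (dist x (geodesic_point c d u))\<^sup>2)" for z
      unfolding flat[OF l0 l1] flat[OF u] f_def by (simp add: algebra_simps)
    show "(dist (geodesic_point (geodesic_point x c s) (geodesic_point x d t) r) z)\<^sup>2 =
        f z - ((1 - r) * s * (1 - s) * (dist x c)\<^sup>2 + r * t * (1 - t) * (dist x d)\<^sup>2
          + r * (1 - r) * (dist (geodesic_point x c s) (geodesic_point x d t))\<^sup>2)" for z
      unfolding flat[OF r] flat[OF s] flat[OF t] f_def lu lu' l' by (simp add: algebra_simps)
  qed
  then show thesis using that l0 l1 u by blast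
qed

text \<open>Written as the image of a product so that compactness follows from joint
  continuity.\<close>

definition geodesic_cone :: "'a::flat_cat0_space \<Rightarrow> 'a set \<Rightarrow> 'a set" where
  "geodesic_cone x C = (\<lambda>(t, c). geodesic_point x c t) ` ({0..1} \<times> C)"

lemma geodesically_convex_cone:
  assumes C: "geodesically_convex C"
  shows "geodesically_convex (geodesic_cone x C)"
  unfolding geodesically_convex_iff
proof (intro ballI)
  fix p q and r :: real
  assume "p \<in> geodesic_cone x C" "q \<in> geodesic_cone x C" "r \<in> {0..1}"
  then obtain s c t d where cd: "c \<in> C" "d \<in> C"
    and st: "0 \<le> s" "s \<le> 1" "0 \<le> t" "t \<le> 1" and r: "0 \<le> r" "r \<le> 1"
    and pq: "p = geodesic_point x c s" "q = geodesic_point x d t"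
    by (auto simp: geodesic_cone_def)
  obtain l u where lu: "0 \<le> l" "l \<le> 1" "0 \<le> u" "u \<le> 1"
    and eq: "geodesic_point p q r = geodesic_point x (geodesic_point c d u) l"
    unfolding pq using geodesic_point_cone[OF r st] by metis
  have "geodesic_point c d u \<in> C" using C cd lu by (auto simp: geodesically_convex_iff)
  then show "geodesic_point p q r \<in> geodesic_cone x C"
    unfolding eq geodesic_cone_def using lu by force
qed

text \<open>Parameter 0 yields the apex and parameter 1 the base. The cone over the empty set is
  empty and misses x, hence the assumption.\<close>

lemma hull_insert_eq_cone:
  fixes F :: "'a::flat_cat0_space set"
  assumes "F \<noteq> {}"
  shows "geodesically_convex hull (insert x F) = geodesic_cone x (geodesically_convex hull F)"
proof (rule hull_unique)
  let ?H = "geodesically_convex hull F"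
  have cone: "geodesic_point x c t \<in> geodesic_cone x ?H" if "c \<in> ?H" "0 \<le> t" "t \<le> 1" for c t
    using that by (force simp: geodesic_cone_def)
  have F: "F \<subseteq> ?H" by (rule hull_subset)
  with assms obtain c where "c \<in> ?H" by blast
  with F show "insert x F \<subseteq> geodesic_cone x ?H"
    using cone[of _ 0] cone[of _ 1] by auto
  show "geodesically_convex (geodesic_cone x ?H)"
    by (intro geodesically_convex_cone geodesically_convex_hull)
  fix T assume T: "insert x F \<subseteq> T" "geodesically_convex T"
  then have "?H \<subseteq> T" by (intro hull_minimal) auto
  then show "geodesic_cone x ?H \<subseteq> T"
    using T by (auto simp: geodesic_cone_def geodesically_convex_iff)
qed

lemma continuous_on_geodesic_point:
  fixes x :: "'a::flat_cat0_space"
  shows "continuous_on ({0..1} \<times> UNIV) (\<lambda>(t, c). geodesic_point x c t)"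
proof -
  have "((\<lambda>(t, c). geodesic_point x c t) \<longlongrightarrow> geodesic_point x c t)
      (at (t, c) within {0..1} \<times> UNIV)" if t: "0 \<le> t" "t \<le> 1" for t c
  proof -
    let ?F = "at (t, c) within {0..1} \<times> UNIV"
    \<comment> \<open>Compare through \<open>geodesic_point x c s\<close>: moving the endpoint at a
      fixed parameter does not increase distance, and changing the parameter slides along one
      segment.\<close>
    have le: "dist (geodesic_point x d s) (geodesic_point x c t) \<le> dist d c + \<bar>s - t\<bar> * dist x c"
      if s: "0 \<le> s" "s \<le> 1" for s d
    proof -
      have "(dist (geodesic_point x d s) (geodesic_point x c s))\<^sup>2 \<le> s * (dist d c)\<^sup>2"
        using dist_square_geodesic_points_le[OF s, of x d x c] by simp
      also have "\<dots> \<le> (dist d c)\<^sup>2" using s by (simp add: mult_left_le_one_le)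
      finally have "dist (geodesic_point x d s) (geodesic_point x c s) \<le> dist d c"
        by (rule power2_le_imp_le) simp
      then show ?thesis
        using dist_triangle[of "geodesic_point x d s" "geodesic_point x c t" "geodesic_point x c s"]
          dist_geodesic_points_same_segment[OF s t, of x c] by simp
    qed
    have "((\<lambda>p. dist (snd p) c + \<bar>fst p - t\<bar> * dist x c) \<longlongrightarrow>
        dist c c + \<bar>t - t\<bar> * dist x c) ?F"
      by (intro tendsto_add tendsto_mult tendsto_dist tendsto_rabs tendsto_diff tendsto_const
          tendsto_snd[where a = "(t, c)", simplified] tendsto_fst[where a = "(t, c)", simplified]
          tendsto_ident_at)
    then have lim: "((\<lambda>p. dist (snd p) c + \<bar>fst p - t\<bar> * dist x c) \<longlongrightarrow> 0) ?F"
      by simp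
    have "\<forall>\<^sub>F p in ?F. norm (dist (case p of (t, c) \<Rightarrow> geodesic_point x c t) (geodesic_point x c t))
        \<le> dist (snd p) c + \<bar>fst p - t\<bar> * dist x c"
      unfolding eventually_at_filter
    proof (rule always_eventually, intro allI impI)
      fix p :: "real \<times> 'a"
      assume "p \<in> {0..1} \<times> UNIV"
      then show "norm (dist (case p of (t, c) \<Rightarrow> geodesic_point x c t) (geodesic_point x c t))
          \<le> dist (snd p) c + \<bar>fst p - t\<bar> * dist x c"
        using le[of "fst p" "snd p"] by (cases p) simp
    qed
    then show ?thesis
      unfolding tendsto_dist_iff[of _ "geodesic_point x c t"] by (rule Lim_null_comparison[OF _ lim])
  qed
  then show ?thesis by (auto simp: continuous_on_def)
qed

section \<open>Compactness of cones and hulls\<close>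

lemma compact_geodesic_cone:
  assumes "compact C"
  shows "compact (geodesic_cone x C)"
  unfolding geodesic_cone_def
  by (intro compact_continuous_image compact_Times compact_Icc assms
      continuous_on_subset[OF continuous_on_geodesic_point]) auto

lemma compact_geodesically_convex_hull_finite:
  fixes F :: "'a::flat_cat0_space set"
  assumes "finite F"
  shows "compact (geodesically_convex hull F)"
  using assms
proof (induction F rule: finite_induct)
  case empty
  have "geodesically_convex hull {} = ({} :: 'a set)"
    by (rule hull_same) (simp add: geodesically_convex_def)
  then show ?case by simp
next
  case (insert x F)
  show ?case
  \<comment> \<open>The singleton is treated apart because the cone formula needs a nonempty
    base.\<close>
  proof (cases "F = {}")
    case True
    have "geodesic_point x x t = x" if "0 \<le> t" "t \<le> 1" for t
      using dist_geodesic_points_same_segment[of t 0 x x] that by simp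
    then have "geodesically_convex hull {x} = {x}"
      by (intro hull_same) (simp add: geodesically_convex_iff)
    then show ?thesis using True by simp
  next
    case False
    then show ?thesis
      using insert.IH by (simp add: hull_insert_eq_cone compact_geodesic_cone)
  qed
qed

lemma compact_closure_geodesically_convex_hull:
  fixes K :: "'a::{flat_cat0_space, complete_space} set"
  assumes "compact K"
  shows "compact (closure (geodesically_convex hull K))"
  unfolding compact_eq_totally_bounded
proof (intro conjI allI impI)
  show "complete (closure (geodesically_convex hull K))"
    by (simp add: complete_eq_closed)
  fix e :: real assume "e > 0"
  \<comment> \<open>One third each for passing from the closure to the hull of K, from there to H,
    and from H to its finite net G.\<close>
  then have e: "e / 3 > 0" by simp
  obtain F where F: "finite F" "K \<subseteq> (\<Union>x\<in>F. ball x (e/3))"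
    using assms e unfolding compact_eq_totally_bounded by blast
  define H where "H = geodesically_convex hull F"
  have "compact H" unfolding H_def by (rule compact_geodesically_convex_hull_finite[OF F(1)])
  then obtain G where G: "finite G" "H \<subseteq> (\<Union>x\<in>G. ball x (e/3))"
    using e unfolding compact_eq_totally_bounded by blast
  have "F \<subseteq> H" unfolding H_def by (rule hull_subset)
  then have "K \<subseteq> (\<Union>c\<in>H. ball c (e/3))" using F(2) by blast
  \<comment> \<open>The neighbourhood of H is convex and contains K, so minimality of the hull
    applies.\<close>
  then have sub: "geodesically_convex hull K \<subseteq> (\<Union>c\<in>H. ball c (e/3))"
    unfolding H_def
    by (intro hull_minimal geodesically_convex_neighbourhood geodesically_convex_hull)
  have "closure (geodesically_convex hull K) \<subseteq> (\<Union>x\<in>G. ball x e)"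
  proof
    fix p assume "p \<in> closure (geodesically_convex hull K)"
    then obtain q where q: "q \<in> geodesically_convex hull K" "dist q p < e/3"
      using e by (meson closure_approachable)
    obtain c where c: "c \<in> H" "dist c q < e/3" using q(1) sub by auto
    obtain g where g: "g \<in> G" "dist g c < e/3" using c(1) G(2) by auto
    have "dist g p < e"
      using dist_triangle[of g p c] dist_triangle[of c p q] q(2) c(2) g(2) by linarith
    then show "p \<in> (\<Union>x\<in>G. ball x e)" using g(1) by auto
  qed
  then show "\<exists>k. finite k \<and> closure (geodesically_convex hull K) \<subseteq> (\<Union>x\<in>k. ball x e)"
    using G(1) by blast
qed

theorem theorem6:
  fixes K :: "'a::{flat_cat0_space, complete_space} set"
  assumes "compact K"
  shows "compact (closure (geodesically_convex hull K)) \<and>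
         (finite K \<longrightarrow> compact (geodesically_convex hull K))"
  using compact_closure_geodesically_convex_hull[OF assms] compact_geodesically_convex_hull_finite
  by blast

end
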